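(* Let $SB_3$ be the singular braid group on $3$ strands and let $ST_3$ be the kernel of the homomorphism $\pi: SB_3\to S_3$ given by $\pi(\sigma_i)=(i,i+1)$, $\pi(\tau_i)=1$ for $i=1,2$. Then the group $ST_3$ is generated by the elements $$a_{12},\ a_{13},\ a_{23},\ c_{12},\ c_{13},\ c_{23}$$ (defined in the context), and in these generators it is defined by the relations \begin{align*} & a_{12}c_{12}=c_{12}a_{12},\\ & a_{13}c_{13}=c_{13}a_{13},\\ & a_{23}c_{23}=c_{23}a_{23},\\ & a_{12}a_{13}a_{12}^{-1}=a_{23}^{-1}a_{13}a_{23},\\ & c_{12}a_{13}a_{23}c_{12}^{-1}=a_{13}a_{23},\\ & a_{12}c_{13}a_{12}^{-1}=a_{23}^{-1}c_{13}a_{23},\\ & a_{12}^{-1}a_{23}a_{12}=a_{13}a_{23}a_{13}^{-1},\\ & a_{12}^{-1}c_{23}a_{12}=a_{13}c_{23}a_{13}^{-1}. \end{align*} That is, these generators and relations form a presentation of $ST_3$.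
   Context: The singular braid group $SB_3$ is the group generated by $\sigma_1,\sigma_2,\tau_1,\tau_2$ with defining relations $$\sigma_1\sigma_2\sigma_1=\sigma_2\sigma_1\sigma_2,\quad \sigma_1\tau_1=\tau_1\sigma_1,\quad \sigma_2\tau_2=\tau_2\sigma_2,\quad \sigma_1\sigma_2\tau_1=\tau_2\sigma_1\sigma_2,\quad \sigma_2\sigma_1\tau_2=\tau_1\sigma_2\sigma_1.$$ $S_3$ is the symmetric group on $3$ symbols and $(i,i+1)$ denotes the transposition. The following elements of $SB_3$ lie in $ST_3$: $$a_{12}=\sigma_1^2,\quad a_{23}=\sigma_2^2,\quad a_{13}=\sigma_2\sigma_1^2\sigma_2^{-1},\quad c_{12}=\tau_1,\quad c_{23}=\tau_2,\quad c_{13}=\sigma_2\tau_1\sigma_2^{-1}.$$ *)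

theory Defs
  imports "HOL-Algebra.Generated_Groups" "HOL-Algebra.Sym_Groups"
begin

section \<open>Groups given by generators and relations\<close>

datatype 'g letter = Gen 'g | Inv 'g

type_synonym 'g word = "'g letter list"

text \<open>A relation \<open>u = v\<close> is the pair \<open>(u, v)\<close> of words. The congruence below contains free
  reduction, so its classes form the quotient of the free group on the type of generators by the
  normal closure of the words \<open>u v\<^sup>-\<^sup>1\<close>.\<close>

inductive word_congr :: "('g word \<times> 'g word) set \<Rightarrow> 'g word \<Rightarrow> 'g word \<Rightarrow> bool"
  for R :: "('g word \<times> 'g word) set" where
  refl: "word_congr R u u"
| sym: "word_congr R u v \<Longrightarrow> word_congr R v u"
| trans: "word_congr R u v \<Longrightarrow> word_congr R v w \<Longrightarrow> word_congr R u w"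
| gen_inv: "word_congr R (u @ [Gen x, Inv x] @ v) (u @ v)"
| inv_gen: "word_congr R (u @ [Inv x, Gen x] @ v) (u @ v)"
| rel: "(l, r) \<in> R \<Longrightarrow> word_congr R (u @ l @ v) (u @ r @ v)"

definition word_class :: "('g word \<times> 'g word) set \<Rightarrow> 'g word \<Rightarrow> 'g word set" where
  "word_class R u = {v. word_congr R u v}"

definition presented_group :: "('g word \<times> 'g word) set \<Rightarrow> 'g word set monoid" where
  "presented_group R =
     \<lparr>carrier = range (word_class R),
      monoid.mult = (\<lambda>A B. {w. \<exists>u\<in>A. \<exists>v\<in>B. word_congr R (u @ v) w}),
      monoid.one = word_class R []\<rparr>"

definition generator :: "('g word \<times> 'g word) set \<Rightarrow> 'g \<Rightarrow> 'g word set" where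
  "generator R x = word_class R [Gen x]"

fun eval_letter :: "('a, 'b) monoid_scheme \<Rightarrow> ('g \<Rightarrow> 'a) \<Rightarrow> 'g letter \<Rightarrow> 'a" where
  "eval_letter G f (Gen x) = f x"
| "eval_letter G f (Inv x) = inv\<^bsub>G\<^esub> (f x)"

fun eval_word :: "('a, 'b) monoid_scheme \<Rightarrow> ('g \<Rightarrow> 'a) \<Rightarrow> 'g word \<Rightarrow> 'a" where
  "eval_word G f [] = \<one>\<^bsub>G\<^esub>"
| "eval_word G f (a # w) = eval_letter G f a \<otimes>\<^bsub>G\<^esub> eval_word G f w"

text \<open>If \<open>f\<close> respects the relations, the value does not depend on the chosen representative, and
  this is the homomorphism sending \<open>generator R x\<close> to \<open>f x\<close>; see \<open>induced_hom_in_hom\<close> and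
  \<open>induced_hom_generator\<close>.\<close>

definition induced_hom :: "('a, 'b) monoid_scheme \<Rightarrow> ('g \<Rightarrow> 'a) \<Rightarrow> 'g word set \<Rightarrow> 'a" where
  "induced_hom G f A = eval_word G f (SOME w. w \<in> A)"

text \<open>The family \<open>f\<close> of elements generates \<open>G\<close>, with defining relations \<open>R\<close>.\<close>

definition is_presentation ::
    "('a, 'b) monoid_scheme \<Rightarrow> ('g \<Rightarrow> 'a) \<Rightarrow> ('g word \<times> 'g word) set \<Rightarrow> bool" where
  "is_presentation G f R \<longleftrightarrow>
     group G \<and> (\<exists>h \<in> iso (presented_group R) G. \<forall>x. h (generator R x) = f x)"

lemma word_congr_append:
  assumes "word_congr R u u'" and "word_congr R v v'"
  shows "word_congr R (u @ v) (u' @ v')"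
proof -
  have l: "word_congr R (w @ u) (w @ u')" if "word_congr R u u'" for u u' w
    using that
  proof induction
    case (gen_inv u x v) show ?case using word_congr.gen_inv[of R "w @ u" x v] by simp
  next
    case (inv_gen u x v) show ?case using word_congr.inv_gen[of R "w @ u" x v] by simp
  next
    case (rel l r u v) then show ?case using word_congr.rel[of l r R "w @ u" v] by simp
  qed (blast intro: word_congr.refl word_congr.sym word_congr.trans)+
  have r: "word_congr R (u @ w) (u' @ w)" if "word_congr R u u'" for u u' w
    using that
  proof induction
    case (gen_inv u x v) show ?case using word_congr.gen_inv[of R u x "v @ w"] by simp
  next
    case (inv_gen u x v) show ?case using word_congr.inv_gen[of R u x "v @ w"] by simp
  next
    case (rel l r u v) then show ?case using word_congr.rel[of l r R u "v @ w"] by simp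
  qed (blast intro: word_congr.refl word_congr.sym word_congr.trans)+
  show ?thesis
    using r[OF assms(1)] l[OF assms(2)] word_congr.trans by blast
qed

lemma word_class_eq_iff: "word_class R u = word_class R v \<longleftrightarrow> word_congr R u v"
  unfolding word_class_def
  by (auto intro: word_congr.refl word_congr.sym word_congr.trans)

lemma presented_group_carrier: "carrier (presented_group R) = range (word_class R)"
  by (simp add: presented_group_def)

lemma presented_group_one: "\<one>\<^bsub>presented_group R\<^esub> = word_class R []"
  by (simp add: presented_group_def)

lemma presented_group_mult:
  "word_class R u \<otimes>\<^bsub>presented_group R\<^esub> word_class R v = word_class R (u @ v)"
  unfolding presented_group_def word_class_def
  by (auto intro: word_congr.refl word_congr.trans word_congr_append)

fun inv_letter :: "'g letter \<Rightarrow> 'g letter" where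
  "inv_letter (Gen x) = Inv x"
| "inv_letter (Inv x) = Gen x"

lemma word_congr_inv_word: "word_congr R (rev (map inv_letter w) @ w) []"
proof (induction w)
  case Nil then show ?case by (simp add: word_congr.refl)
next
  case (Cons a w)
  have "word_congr R (rev (map inv_letter w) @ [inv_letter a, a] @ w) (rev (map inv_letter w) @ w)"
    by (cases a) (use word_congr.inv_gen word_congr.gen_inv in fastforce)+
  with Cons show ?case using word_congr.trans by fastforce
qed

lemma presented_group_is_group: "group (presented_group R)"
proof (rule groupI)
  fix A assume "A \<in> carrier (presented_group R)"
  then obtain w where A: "A = word_class R w" by (auto simp: presented_group_carrier)
  show "\<exists>B\<in>carrier (presented_group R). B \<otimes>\<^bsub>presented_group R\<^esub> A = \<one>\<^bsub>presented_group R\<^esub>"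
    by (rule bexI[of _ "word_class R (rev (map inv_letter w))"])
       (auto simp: A presented_group_mult presented_group_one presented_group_carrier
          word_class_eq_iff word_congr_inv_word)
qed (auto simp: presented_group_carrier presented_group_mult presented_group_one)

context
  fixes G :: "('a, 'b) monoid_scheme" and f :: "'g \<Rightarrow> 'a" and R :: "('g word \<times> 'g word) set"
  assumes G: "group G" and f: "\<And>x. f x \<in> carrier G"
    and rels: "\<And>l r. (l, r) \<in> R \<Longrightarrow> eval_word G f l = eval_word G f r"
begin

interpretation group G by (rule G)

lemma eval_letter_closed: "eval_letter G f a \<in> carrier G"
  by (cases a) (auto simp: f)

lemma eval_word_closed: "eval_word G f w \<in> carrier G"
  by (induction w) (auto simp: eval_letter_closed)

lemma eval_word_append: "eval_word G f (u @ v) = eval_word G f u \<otimes>\<^bsub>G\<^esub> eval_word G f v"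
  by (induction u) (auto simp: eval_letter_closed eval_word_closed m_assoc)

lemma eval_word_cong: "word_congr R u v \<Longrightarrow> eval_word G f u = eval_word G f v"
proof (induction rule: word_congr.induct)
  case (gen_inv u x v)
  then show ?case
    by (simp add: eval_word_append f eval_word_closed m_assoc[symmetric])
next
  case (inv_gen u x v)
  then show ?case
    by (simp add: eval_word_append f eval_word_closed m_assoc[symmetric])
qed (auto simp: eval_word_append rels)

lemma induced_hom_word_class: "induced_hom G f (word_class R w) = eval_word G f w"
proof -
  have "w \<in> word_class R w" by (simp add: word_class_def word_congr.refl)
  then have "(SOME v. v \<in> word_class R w) \<in> word_class R w" by (rule someI)
  then show ?thesis unfolding induced_hom_def
    using eval_word_cong by (simp add: word_class_def)
qed

lemma induced_hom_in_hom: "induced_hom G f \<in> hom (presented_group R) G"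
  by (rule homI)
     (auto simp: presented_group_carrier presented_group_mult induced_hom_word_class
        eval_word_closed eval_word_append)

lemma induced_hom_generator: "induced_hom G f (generator R x) = f x"
  by (simp add: generator_def induced_hom_word_class f)

end

section \<open>The singular braid group on three strands\<close>

datatype sb3_gen = Sigma1 | Sigma2 | Tau1 | Tau2

definition sb3_rels :: "(sb3_gen word \<times> sb3_gen word) set" where
  "sb3_rels =
    {([Gen Sigma1, Gen Sigma2, Gen Sigma1], [Gen Sigma2, Gen Sigma1, Gen Sigma2]),
     ([Gen Sigma1, Gen Tau1], [Gen Tau1, Gen Sigma1]),
     ([Gen Sigma2, Gen Tau2], [Gen Tau2, Gen Sigma2]),
     ([Gen Sigma1, Gen Sigma2, Gen Tau1], [Gen Tau2, Gen Sigma1, Gen Sigma2]),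
     ([Gen Sigma2, Gen Sigma1, Gen Tau2], [Gen Tau1, Gen Sigma2, Gen Sigma1])}"

definition SB3 :: "sb3_gen word set monoid" where
  "SB3 = presented_group sb3_rels"

definition \<sigma>\<^sub>1 :: "sb3_gen word set" where "\<sigma>\<^sub>1 = generator sb3_rels Sigma1"
definition \<sigma>\<^sub>2 :: "sb3_gen word set" where "\<sigma>\<^sub>2 = generator sb3_rels Sigma2"
definition \<tau>\<^sub>1 :: "sb3_gen word set" where "\<tau>\<^sub>1 = generator sb3_rels Tau1"
definition \<tau>\<^sub>2 :: "sb3_gen word set" where "\<tau>\<^sub>2 = generator sb3_rels Tau2"

fun sb3_perm :: "sb3_gen \<Rightarrow> nat \<Rightarrow> nat" where
  "sb3_perm Sigma1 = transpose 1 2"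
| "sb3_perm Sigma2 = transpose 2 3"
| "sb3_perm Tau1 = id"
| "sb3_perm Tau2 = id"

definition \<pi> :: "sb3_gen word set \<Rightarrow> nat \<Rightarrow> nat" where
  "\<pi> = induced_hom (sym_group 3) sb3_perm"

definition ST3 :: "sb3_gen word set monoid" where
  "ST3 = SB3\<lparr>carrier := kernel SB3 (sym_group 3) \<pi>\<rparr>"

lemma sb3_perm_closed: "sb3_perm x \<in> carrier (sym_group 3)"
  by (cases x) (auto simp: sym_group_carrier permutes_id intro!: permutes_swap_id)

lemma sb3_perm_rels:
  assumes "(l, r) \<in> sb3_rels"
  shows "eval_word (sym_group 3) sb3_perm l = eval_word (sym_group 3) sb3_perm r"
  using assms unfolding sb3_rels_def
  by (auto simp: sym_group_mult sym_group_one fun_eq_iff transpose_def)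

lemma SB3_is_group: "group SB3"
  unfolding SB3_def by (rule presented_group_is_group)

lemma \<pi>_hom: "\<pi> \<in> hom SB3 (sym_group 3)"
  unfolding \<pi>_def SB3_def
  by (rule induced_hom_in_hom[OF sym_group_is_group sb3_perm_closed sb3_perm_rels])

lemma \<pi>_generators:
  "\<pi> \<sigma>\<^sub>1 = transpose 1 2" "\<pi> \<sigma>\<^sub>2 = transpose 2 3" "\<pi> \<tau>\<^sub>1 = \<one>\<^bsub>sym_group 3\<^esub>" "\<pi> \<tau>\<^sub>2 = \<one>\<^bsub>sym_group 3\<^esub>"
  unfolding \<pi>_def \<sigma>\<^sub>1_def \<sigma>\<^sub>2_def \<tau>\<^sub>1_def \<tau>\<^sub>2_def
  by (simp_all add: sym_group_one
        induced_hom_generator[OF sym_group_is_group sb3_perm_closed sb3_perm_rels])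

section \<open>The presentation of the kernel\<close>

datatype st3_gen = A12 | A13 | A23 | C12 | C13 | C23

fun st3_elem :: "st3_gen \<Rightarrow> sb3_gen word set" where
  "st3_elem A12 = \<sigma>\<^sub>1 [^]\<^bsub>SB3\<^esub> (2::nat)"
| "st3_elem A23 = \<sigma>\<^sub>2 [^]\<^bsub>SB3\<^esub> (2::nat)"
| "st3_elem A13 = \<sigma>\<^sub>2 \<otimes>\<^bsub>SB3\<^esub> \<sigma>\<^sub>1 [^]\<^bsub>SB3\<^esub> (2::nat) \<otimes>\<^bsub>SB3\<^esub> inv\<^bsub>SB3\<^esub> \<sigma>\<^sub>2"
| "st3_elem C12 = \<tau>\<^sub>1"
| "st3_elem C23 = \<tau>\<^sub>2"
| "st3_elem C13 = \<sigma>\<^sub>2 \<otimes>\<^bsub>SB3\<^esub> \<tau>\<^sub>1 \<otimes>\<^bsub>SB3\<^esub> inv\<^bsub>SB3\<^esub> \<sigma>\<^sub>2"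

definition st3_rels :: "(st3_gen word \<times> st3_gen word) set" where
  "st3_rels =
    {([Gen A12, Gen C12], [Gen C12, Gen A12]),
     ([Gen A13, Gen C13], [Gen C13, Gen A13]),
     ([Gen A23, Gen C23], [Gen C23, Gen A23]),
     ([Gen A12, Gen A13, Inv A12], [Inv A23, Gen A13, Gen A23]),
     ([Gen C12, Gen A13, Gen A23, Inv C12], [Gen A13, Gen A23]),
     ([Gen A12, Gen C13, Inv A12], [Inv A23, Gen C13, Gen A23]),
     ([Inv A12, Gen A23, Gen A12], [Gen A13, Gen A23, Inv A13]),
     ([Inv A12, Gen C23, Gen A12], [Gen A13, Gen C23, Inv A13])}"

end

(* Reidemeister-Schreier rewriting with coset representatives 1, s1, s2, s1 s2, s2 s1, s1 s2 s1.
   Reading a word of SB3 while tracking its coset produces a word in the six generators, and every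
   defining relation of SB3, read from any of the six cosets, becomes a consequence of the eight
   relations. Hence the rewriting is well defined on SB3. Started at the trivial coset it is a left
   inverse of the map from the presented group to SB3, which is therefore injective; and since it
   expresses each element of SB3 as a product of generators times a representative, the image of
   this map is the kernel. *)

theory Submission
  imports Defs
begin

section \<open>Identities in groups satisfying the relations\<close>

context group
begin

lemma inv_mult_cancel [simp]: "x \<in> carrier G \<Longrightarrow> z \<in> carrier G \<Longrightarrow> inv x \<otimes> (x \<otimes> z) = z"
  by (simp flip: m_assoc)

lemma mult_inv_cancel [simp]: "x \<in> carrier G \<Longrightarrow> z \<in> carrier G \<Longrightarrow> x \<otimes> (inv x \<otimes> z) = z"
  by (simp flip: m_assoc)

text \<open>\<open>m_assoc\<close> nests products to the right, so a rule with a two-factor left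
  side misses occurrences followed by further factors. This produces the variant with a tail
  \<open>w\<close>.\<close>

lemma eq_imp_mult_eq:
  assumes "x \<otimes> y = z" "x \<in> carrier G" "y \<in> carrier G" "w \<in> carrier G"
  shows "x \<otimes> (y \<otimes> w) = z \<otimes> w"
  using assms by (metis m_assoc)

lemma eq_imp_mult_eq3:
  assumes "x \<otimes> (y \<otimes> v) = z"
    "x \<in> carrier G" "y \<in> carrier G" "v \<in> carrier G" "w \<in> carrier G"
  shows "x \<otimes> (y \<otimes> (v \<otimes> w)) = z \<otimes> w"
  using assms by (auto simp: m_assoc)

end

section \<open>Consequences of the eight relations, oriented as rewrite rules\<close>

locale st3_group = group G for G (structure) +
  fixes a12 a13 a23 c12 c13 c23
  assumes closed [simp]: "a12 \<in> carrier G" "a13 \<in> carrier G" "a23 \<in> carrier G"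
      "c12 \<in> carrier G" "c13 \<in> carrier G" "c23 \<in> carrier G"
    and r1: "a12 \<otimes> c12 = c12 \<otimes> a12"
    and r2: "a13 \<otimes> c13 = c13 \<otimes> a13"
    and r3: "a23 \<otimes> c23 = c23 \<otimes> a23"
    and r4: "a12 \<otimes> (a13 \<otimes> inv a12) = inv a23 \<otimes> (a13 \<otimes> a23)"
    and r5: "c12 \<otimes> (a13 \<otimes> (a23 \<otimes> inv c12)) = a13 \<otimes> a23"
    and r6: "a12 \<otimes> (c13 \<otimes> inv a12) = inv a23 \<otimes> (c13 \<otimes> a23)"
    and r7: "inv a12 \<otimes> (a23 \<otimes> a12) = a13 \<otimes> (a23 \<otimes> inv a13)"
    and r8: "inv a12 \<otimes> (c23 \<otimes> a12) = a13 \<otimes> (c23 \<otimes> inv a13)"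
begin

lemma a12_a13_eq: "inv a23 \<otimes> (a13 \<otimes> (a23 \<otimes> a12)) = a12 \<otimes> a13"
proof -
  have "inv a23 \<otimes> (a13 \<otimes> (a23 \<otimes> a12)) = (inv a23 \<otimes> (a13 \<otimes> a23)) \<otimes> a12"
    by (simp add: m_assoc)
  then show ?thesis by (simp add: m_assoc flip: r4)
qed

lemma c12_commutes: "c12 \<otimes> (a13 \<otimes> a23) = a13 \<otimes> (a23 \<otimes> c12)"
proof -
  have "a13 \<otimes> (a23 \<otimes> c12) = (a13 \<otimes> a23) \<otimes> c12"
    by (simp add: m_assoc)
  then show ?thesis by (simp add: m_assoc flip: r5)
qed

lemma a12_c13_eq: "inv a23 \<otimes> (c13 \<otimes> (a23 \<otimes> a12)) = a12 \<otimes> c13"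
proof -
  have "inv a23 \<otimes> (c13 \<otimes> (a23 \<otimes> a12)) = (inv a23 \<otimes> (c13 \<otimes> a23)) \<otimes> a12"
    by (simp add: m_assoc)
  then show ?thesis by (simp add: m_assoc flip: r6)
qed

text \<open>\<open>a12_a13_eq\<close> turns the left side into a23 a12 a13, and \<open>r7\<close>
  then carries a23 past a12.\<close>

lemma a13_a23_a12_eq: "a13 \<otimes> (a23 \<otimes> a12) = a12 \<otimes> (a13 \<otimes> a23)"
proof -
  have "a13 \<otimes> (a23 \<otimes> a12) = a23 \<otimes> (inv a23 \<otimes> (a13 \<otimes> (a23 \<otimes> a12)))"
    by simp
  also have "\<dots> = a12 \<otimes> (inv a12 \<otimes> (a23 \<otimes> a12)) \<otimes> a13"
    unfolding a12_a13_eq by (simp add: m_assoc)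
  also have "\<dots> = a12 \<otimes> (a13 \<otimes> a23)"
    unfolding r7 by (simp add: m_assoc)
  finally show ?thesis .
qed

lemma c23_commutes: "c23 \<otimes> (a12 \<otimes> a13) = a12 \<otimes> (a13 \<otimes> c23)"
proof -
  have "c23 \<otimes> (a12 \<otimes> a13) = a12 \<otimes> (inv a12 \<otimes> (c23 \<otimes> a12)) \<otimes> a13"
    by (simp add: m_assoc)
  then show ?thesis by (simp add: m_assoc r8)
qed

text \<open>Closes the critical pair of \<open>a12_a13_eq\<close> and \<open>a13_a23_a12_eq\<close>, which are not confluent as
  rewrite rules.\<close>

lemma a12_a13_a23_eq: "inv a23 \<otimes> (a12 \<otimes> (a13 \<otimes> a23)) = a12 \<otimes> a13"
  using a12_a13_eq unfolding a13_a23_a12_eq .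

lemma a23_commutes: "a23 \<otimes> (a12 \<otimes> a13) = a12 \<otimes> (a13 \<otimes> a23)"
  by (simp flip: a12_a13_a23_eq)

lemma a12_a13_a23_eq':
  assumes "w \<in> carrier G"
  shows "inv a23 \<otimes> (a12 \<otimes> (a13 \<otimes> (a23 \<otimes> w))) = a12 \<otimes> (a13 \<otimes> w)"
  using assms arg_cong[OF a12_a13_a23_eq, of "\<lambda>z. z \<otimes> w"] by (simp add: m_assoc)

text \<open>With these orientations both sides of every case of \<open>rewrite_rel\<close> reach a
  common form. \<open>r3\<close> is reversed so that c23 moves right, as in
  \<open>c23_commutes\<close>.\<close>

lemmas normalize = r1 r2 r3[symmetric] a12_a13_a23_eq c12_commutes a12_c13_eq
  a13_a23_a12_eq c23_commutes a23_commutes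

lemmas normalize' = a12_a13_a23_eq'
  r1[THEN eq_imp_mult_eq] r2[THEN eq_imp_mult_eq] r3[symmetric, THEN eq_imp_mult_eq]
  c12_commutes[THEN eq_imp_mult_eq3] a12_c13_eq[THEN eq_imp_mult_eq3]
  a13_a23_a12_eq[THEN eq_imp_mult_eq3] c23_commutes[THEN eq_imp_mult_eq3]
  a23_commutes[THEN eq_imp_mult_eq3]

end

section \<open>The eight relations derived in the singular braid group, with x, y, s, t for
  \<open>Sigma1\<close>, \<open>Sigma2\<close>, \<open>Tau1\<close>, \<open>Tau2\<close>\<close>

locale sb3_group = group G for G (structure) +
  fixes x y s t
  assumes closed [simp]: "x \<in> carrier G" "y \<in> carrier G" "s \<in> carrier G" "t \<in> carrier G"
    and braid: "x \<otimes> (y \<otimes> x) = y \<otimes> (x \<otimes> y)"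
    and xs: "x \<otimes> s = s \<otimes> x"
    and yt: "y \<otimes> t = t \<otimes> y"
    and xys: "x \<otimes> (y \<otimes> s) = t \<otimes> (x \<otimes> y)"
    and yxt: "y \<otimes> (x \<otimes> t) = s \<otimes> (y \<otimes> x)"
begin

definition a13 where "a13 = y \<otimes> (x \<otimes> (x \<otimes> inv y))"
definition c13 where "c13 = y \<otimes> (s \<otimes> inv y)"

lemma closed' [simp]: "a13 \<in> carrier G" "c13 \<in> carrier G"
  by (simp_all add: a13_def c13_def)

text \<open>Capitals in lemma names denote inverses. This and the next three identities recast the
  defining relations as conjugations, trading conjugation by one of x, y for inverse conjugation by
  the other.\<close>

lemma yxY: "y \<otimes> (x \<otimes> inv y) = inv x \<otimes> (y \<otimes> x)"
proof -
  have "x \<otimes> (y \<otimes> (x \<otimes> inv y)) = y \<otimes> x"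
    using braid by (simp flip: m_assoc) (simp add: m_assoc)
  then show ?thesis by (metis closed inv_closed m_closed inv_mult_cancel)
qed

lemma xyX: "x \<otimes> (y \<otimes> inv x) = inv y \<otimes> (x \<otimes> y)"
proof -
  have "y \<otimes> (x \<otimes> (y \<otimes> inv x)) = x \<otimes> y"
    using braid[symmetric] by (simp flip: m_assoc) (simp add: m_assoc)
  then show ?thesis by (metis closed inv_closed m_closed inv_mult_cancel)
qed

lemma ysY: "y \<otimes> (s \<otimes> inv y) = inv x \<otimes> (t \<otimes> x)"
proof -
  have "x \<otimes> (y \<otimes> (s \<otimes> inv y)) = t \<otimes> x"
    using xys by (simp flip: m_assoc) (simp add: m_assoc)
  then show ?thesis by (metis closed inv_closed m_closed inv_mult_cancel)
qed

lemma xtX: "x \<otimes> (t \<otimes> inv x) = inv y \<otimes> (s \<otimes> y)"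
proof -
  have "y \<otimes> (x \<otimes> (t \<otimes> inv x)) = s \<otimes> y"
    using yxt by (simp flip: m_assoc) (simp add: m_assoc)
  then show ?thesis by (metis closed inv_closed m_closed inv_mult_cancel)
qed

text \<open>a13 is the square of y x y^-1, to which \<open>yxY\<close> applies.\<close>

lemma a13': "a13 = inv x \<otimes> (y \<otimes> (y \<otimes> x))"
proof -
  have "a13 = (y \<otimes> (x \<otimes> inv y)) \<otimes> (y \<otimes> (x \<otimes> inv y))"
    by (simp add: a13_def m_assoc)
  also have "\<dots> = inv x \<otimes> (y \<otimes> (y \<otimes> x))"
    unfolding yxY by (simp add: m_assoc)
  finally show ?thesis .
qed

lemma xyyX: "x \<otimes> (y \<otimes> (y \<otimes> inv x)) = inv y \<otimes> (x \<otimes> (x \<otimes> y))"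
proof -
  have "x \<otimes> (y \<otimes> (y \<otimes> inv x)) = (x \<otimes> (y \<otimes> inv x)) \<otimes> (x \<otimes> (y \<otimes> inv x))"
    by (simp add: m_assoc)
  also have "\<dots> = inv y \<otimes> (x \<otimes> (x \<otimes> y))"
    unfolding xyX by (simp add: m_assoc)
  finally show ?thesis .
qed

lemma c13': "c13 = inv x \<otimes> (t \<otimes> x)"
  by (simp add: c13_def ysY)

lemma yXY: "y \<otimes> (inv x \<otimes> inv y) = inv x \<otimes> (inv y \<otimes> x)"
  using yxY[THEN arg_cong, of "\<lambda>z. inv z"] by (simp add: inv_mult_group m_assoc)

lemma rel1: "x \<otimes> x \<otimes> s = s \<otimes> (x \<otimes> x)"
  by (metis closed m_assoc xs)

lemma rel2: "a13 \<otimes> c13 = c13 \<otimes> a13"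
proof -
  have "a13 \<otimes> c13 = y \<otimes> ((x \<otimes> x \<otimes> s) \<otimes> inv y)"
    by (simp add: a13_def c13_def m_assoc)
  also have "\<dots> = c13 \<otimes> a13"
    unfolding rel1 by (simp add: a13_def c13_def m_assoc)
  finally show ?thesis .
qed

lemma rel3: "y \<otimes> y \<otimes> t = t \<otimes> (y \<otimes> y)"
  by (metis closed m_assoc yt)

lemma rel4: "x \<otimes> x \<otimes> a13 \<otimes> inv (x \<otimes> x) = inv (y \<otimes> y) \<otimes> a13 \<otimes> (y \<otimes> y)"
proof -
  have "x \<otimes> x \<otimes> a13 \<otimes> inv (x \<otimes> x) = x \<otimes> (y \<otimes> (y \<otimes> inv x))"
    by (simp add: a13' m_assoc inv_mult_group)
  also have "\<dots> = inv (y \<otimes> y) \<otimes> a13 \<otimes> (y \<otimes> y)"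
    unfolding xyyX by (simp add: a13_def m_assoc inv_mult_group)
  finally show ?thesis .
qed

text \<open>a13 y^2 equals y x x y. Passing s through y x turns it into t, and passing t through x y
  turns it back into s.\<close>

lemma rel5: "s \<otimes> (a13 \<otimes> (y \<otimes> y)) = a13 \<otimes> (y \<otimes> y) \<otimes> s"
proof -
  have "s \<otimes> (a13 \<otimes> (y \<otimes> y)) = (s \<otimes> (y \<otimes> x)) \<otimes> (x \<otimes> y)"
    by (simp add: a13_def m_assoc)
  also have "\<dots> = y \<otimes> (x \<otimes> (t \<otimes> (x \<otimes> y)))"
    by (simp flip: yxt add: m_assoc)
  also have "\<dots> = a13 \<otimes> (y \<otimes> y) \<otimes> s"
    by (simp flip: xys add: m_assoc a13_def)
  finally show ?thesis .
qed

lemma rel6: "x \<otimes> x \<otimes> c13 \<otimes> inv (x \<otimes> x) = inv (y \<otimes> y) \<otimes> c13 \<otimes> (y \<otimes> y)"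
proof -
  have "x \<otimes> x \<otimes> c13 \<otimes> inv (x \<otimes> x) = x \<otimes> (t \<otimes> inv x)"
    by (simp add: c13' m_assoc inv_mult_group)
  also have "\<dots> = inv (y \<otimes> y) \<otimes> c13 \<otimes> (y \<otimes> y)"
    unfolding xtX by (simp add: c13_def m_assoc inv_mult_group)
  finally show ?thesis .
qed

text \<open>Common form of the last two relations. The pairs (z, w) = (y^2, x^2) and (t, s) satisfy
  the same hypotheses: z commutes with y, w commutes with x, and conjugation exchanges them.\<close>

lemma rel78:
  assumes "z \<in> carrier G" "w \<in> carrier G" and yz: "y \<otimes> z = z \<otimes> y"
    and xz: "x \<otimes> (z \<otimes> inv x) = inv y \<otimes> (w \<otimes> y)"
    and xw: "x \<otimes> w = w \<otimes> x"
    and yw: "y \<otimes> (w \<otimes> inv y) = inv x \<otimes> (z \<otimes> x)"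
  shows "inv (x \<otimes> x) \<otimes> z \<otimes> (x \<otimes> x) = a13 \<otimes> z \<otimes> inv a13"
proof -
  have [simp]: "w \<in> carrier G" "z \<in> carrier G" by fact+
  \<comment> \<open>Collapses the inner y^-1 z y that appears when a13 and its inverse are expanded,
    leaving z between powers of x.\<close>
  have "inv y \<otimes> (z \<otimes> (y \<otimes> u)) = z \<otimes> u" if "u \<in> carrier G" for u
    using that eq_imp_mult_eq[OF yz[symmetric]] by (simp add: m_assoc)
  then have "a13 \<otimes> z \<otimes> inv a13 = y \<otimes> (x \<otimes> (x \<otimes> (z \<otimes> inv x)) \<otimes> (inv x \<otimes> inv y))"
    by (simp add: a13_def m_assoc inv_mult_group flip: yz)
  also have "\<dots> = (y \<otimes> (x \<otimes> inv y)) \<otimes> w \<otimes> (y \<otimes> (inv x \<otimes> inv y))"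
    unfolding xz by (simp add: m_assoc)
  also have "\<dots> = inv x \<otimes> (y \<otimes> ((x \<otimes> w) \<otimes> (inv x \<otimes> (inv y \<otimes> x))))"
    unfolding yxY yXY by (simp add: m_assoc)
  also have "\<dots> = inv x \<otimes> ((y \<otimes> (w \<otimes> inv y)) \<otimes> x)"
    unfolding xw by (simp add: m_assoc)
  also have "\<dots> = inv (x \<otimes> x) \<otimes> z \<otimes> (x \<otimes> x)"
    unfolding yw by (simp add: m_assoc inv_mult_group)
  finally show ?thesis by simp
qed

lemma rel7: "inv (x \<otimes> x) \<otimes> (y \<otimes> y) \<otimes> (x \<otimes> x) = a13 \<otimes> (y \<otimes> y) \<otimes> inv a13"
  by (rule rel78[of _ "x \<otimes> x"])
    (use xyyX a13' in \<open>simp_all add: m_assoc a13_def\<close>)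

lemma rel8: "inv (x \<otimes> x) \<otimes> t \<otimes> (x \<otimes> x) = a13 \<otimes> t \<otimes> inv a13"
  by (rule rel78[of _ s]) (simp_all add: yt xtX xs ysY)

lemma st3_group: "st3_group G (x \<otimes> x) a13 (y \<otimes> y) s c13 t"
proof unfold_locales
  \<comment> \<open>\<open>rel5\<close> is free of inverses, so \<open>r5\<close> is regrouped to
    expose its left side.\<close>
  have "s \<otimes> (a13 \<otimes> (y \<otimes> y \<otimes> inv s)) = (s \<otimes> (a13 \<otimes> (y \<otimes> y))) \<otimes> inv s"
    by (simp add: m_assoc)
  then show "s \<otimes> (a13 \<otimes> (y \<otimes> y \<otimes> inv s)) = a13 \<otimes> (y \<otimes> y)"
    unfolding rel5 by (simp add: m_assoc)
qed (use rel1 rel2 rel3 rel4 rel6 rel7 rel8 in \<open>simp_all add: m_assoc\<close>)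

end

section \<open>Words and their values\<close>

abbreviation inv_word :: "'g word \<Rightarrow> 'g word" where
  "inv_word w \<equiv> rev (map inv_letter w)"

lemma inv_letter_inv_letter [simp]: "inv_letter (inv_letter a) = a"
  by (cases a) auto

lemma inv_word_inv_word: "inv_word (inv_word w) = w"
  by (simp add: rev_map comp_def)

lemma word_congr_inv_word': "word_congr R (w @ inv_word w) []"
  using word_congr_inv_word[of R "inv_word w"] by (simp only: inv_word_inv_word)

lemma word_class_inv_word: "word_class R (inv_word w) = inv\<^bsub>presented_group R\<^esub> word_class R w"
proof -
  interpret group "presented_group R" by (rule presented_group_is_group)
  show ?thesis
    by (rule inv_equality[symmetric])
      (auto simp: presented_group_mult presented_group_one presented_group_carrier
        word_class_eq_iff word_congr_inv_word)
qed

lemma generator_closed: "generator R x \<in> carrier (presented_group R)"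
  by (simp add: generator_def presented_group_carrier)

text \<open>Lets congruences of words be proved by calculation in the presented group, as in
  \<open>rewrite_rel\<close>.\<close>

lemma eval_word_generator: "eval_word (presented_group R) (generator R) w = word_class R w"
proof (induction w)
  case Nil show ?case by (simp add: presented_group_one)
next
  case (Cons a w)
  have "eval_letter (presented_group R) (generator R) a = word_class R [a]"
    using word_class_inv_word[of R "[Gen x]" for x]
    by (cases a) (simp_all add: generator_def)
  with Cons show ?case by (simp add: presented_group_mult)
qed

lemma (in group) eval_inv_word:
  assumes "\<And>x. f x \<in> carrier G"
  shows "eval_word G f (inv_word w) = inv (eval_word G f w)"
proof -
  have l: "eval_letter G f a \<in> carrier G" for a
    using assms by (cases a) auto
  have il: "eval_letter G f (inv_letter a) = inv (eval_letter G f a)" for a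
    using assms by (cases a) auto
  have c: "eval_word G f w \<in> carrier G" for w
    by (induction w) (auto simp: l)
  have "eval_word G f (u @ v) = eval_word G f u \<otimes> eval_word G f v" for u v
    by (induction u) (auto simp: l c m_assoc)
  then show ?thesis
    by (induction w) (auto simp: l il c inv_mult_group)
qed

section \<open>The Reidemeister-Schreier rewriting\<close>

datatype coset = E | S1 | S2 | S12 | S21 | S121

text \<open>The list is closed under prefixes, and \<open>Sigma2 Sigma1 Sigma2\<close> equals its
  longest member by the braid relation. This accounts for the six pairs on which
  \<open>rewrite_gen\<close> is empty.\<close>

fun rep :: "coset \<Rightarrow> sb3_gen word" where
  "rep E = []"
| "rep S1 = [Gen Sigma1]"
| "rep S2 = [Gen Sigma2]"
| "rep S12 = [Gen Sigma1, Gen Sigma2]"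
| "rep S21 = [Gen Sigma2, Gen Sigma1]"
| "rep S121 = [Gen Sigma1, Gen Sigma2, Gen Sigma1]"

fun next_gen :: "coset \<Rightarrow> sb3_gen \<Rightarrow> coset" where
  "next_gen E Sigma1 = S1"
| "next_gen S1 Sigma1 = E"
| "next_gen S2 Sigma1 = S21"
| "next_gen S21 Sigma1 = S2"
| "next_gen S12 Sigma1 = S121"
| "next_gen S121 Sigma1 = S12"
| "next_gen E Sigma2 = S2"
| "next_gen S2 Sigma2 = E"
| "next_gen S1 Sigma2 = S12"
| "next_gen S12 Sigma2 = S1"
| "next_gen S21 Sigma2 = S121"
| "next_gen S121 Sigma2 = S21"
| "next_gen t Tau1 = t"
| "next_gen t Tau2 = t"

text \<open>The word for \<open>rep t \<cdot> x \<cdot> (rep (next_gen t x))\<^sup>-\<^sup>1\<close>.\<close>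

fun rewrite_gen :: "coset \<Rightarrow> sb3_gen \<Rightarrow> st3_gen word" where
  "rewrite_gen S1 Sigma1 = [Gen A12]"
| "rewrite_gen S21 Sigma1 = [Gen A13]"
| "rewrite_gen S121 Sigma1 = [Gen A23]"
| "rewrite_gen S2 Sigma2 = [Gen A23]"
| "rewrite_gen S12 Sigma2 = [Inv A23, Gen A13, Gen A23]"
| "rewrite_gen S121 Sigma2 = [Gen A12]"
| "rewrite_gen E Tau1 = [Gen C12]"
| "rewrite_gen S1 Tau1 = [Gen C12]"
| "rewrite_gen S2 Tau1 = [Gen C13]"
| "rewrite_gen S21 Tau1 = [Gen C13]"
| "rewrite_gen S12 Tau1 = [Gen C23]"
| "rewrite_gen S121 Tau1 = [Gen C23]"
| "rewrite_gen E Tau2 = [Gen C23]"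
| "rewrite_gen S2 Tau2 = [Gen C23]"
| "rewrite_gen S1 Tau2 = [Inv A23, Gen C13, Gen A23]"
| "rewrite_gen S12 Tau2 = [Inv A23, Gen C13, Gen A23]"
| "rewrite_gen S21 Tau2 = [Gen C12]"
| "rewrite_gen S121 Tau2 = [Gen C12]"
| "rewrite_gen t x = []"

text \<open>Each generator acts on the cosets as an involution, so a generator and its inverse
  lead to the same coset.\<close>

fun next_letter :: "coset \<Rightarrow> sb3_gen letter \<Rightarrow> coset" where
  "next_letter t (Gen x) = next_gen t x"
| "next_letter t (Inv x) = next_gen t x"

text \<open>Reading \<open>Inv x\<close> from \<open>t\<close> retraces the edge labelled
  \<open>x\<close> from \<open>next_gen t x\<close> back to \<open>t\<close>, hence the inverse of
  that edge's word.\<close>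

fun rewrite_letter :: "coset \<Rightarrow> sb3_gen letter \<Rightarrow> st3_gen word" where
  "rewrite_letter t (Gen x) = rewrite_gen t x"
| "rewrite_letter t (Inv x) = inv_word (rewrite_gen (next_gen t x) x)"

fun next_coset :: "coset \<Rightarrow> sb3_gen word \<Rightarrow> coset" where
  "next_coset t [] = t"
| "next_coset t (a # w) = next_coset (next_letter t a) w"

fun rewrite :: "coset \<Rightarrow> sb3_gen word \<Rightarrow> st3_gen word" where
  "rewrite t [] = []"
| "rewrite t (a # w) = rewrite_letter t a @ rewrite (next_letter t a) w"

lemma next_gen_next_gen [simp]: "next_gen (next_gen t x) x = t"
  by (cases t; cases x) auto

lemma next_coset_append: "next_coset t (u @ v) = next_coset (next_coset t u) v"
  by (induction u arbitrary: t) auto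

lemma rewrite_append: "rewrite t (u @ v) = rewrite t u @ rewrite (next_coset t u) v"
  by (induction u arbitrary: t) auto

section \<open>Invariance of the rewriting under the relations\<close>

interpretation P: group "presented_group st3_rels"
  by (rule presented_group_is_group)

lemma eval_word_presented_rel:
  assumes "(l, r) \<in> R"
  shows "eval_word (presented_group R) (generator R) l = eval_word (presented_group R) (generator R) r"
  using word_congr.rel[OF assms, of "[]" "[]"]
  by (simp add: word_class_eq_iff eval_word_generator)

lemma (in group) st3_groupI:
  assumes "\<And>x. f x \<in> carrier G"
    and "\<And>l r. (l, r) \<in> st3_rels \<Longrightarrow> eval_word G f l = eval_word G f r"
  shows "st3_group G (f A12) (f A13) (f A23) (f C12) (f C13) (f C23)"
proof -
  \<comment> \<open>As a bounded quantifier over an explicit finite set, this simplifies to the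
    conjunction of the eight equations.\<close>
  have "\<forall>(l, r) \<in> st3_rels. eval_word G f l = eval_word G f r"
    using assms(2) by blast
  then show ?thesis
    unfolding st3_rels_def using assms(1) by unfold_locales simp_all
qed

lemma (in group) st3_groupD:
  assumes "\<And>x. f x \<in> carrier G"
    and "st3_group G (f A12) (f A13) (f A23) (f C12) (f C13) (f C23)"
    and "(l, r) \<in> st3_rels"
  shows "eval_word G f l = eval_word G f r"
proof -
  interpret st3_group G "f A12" "f A13" "f A23" "f C12" "f C13" "f C23" by fact
  show ?thesis
    using assms(3) unfolding st3_rels_def
    by (auto simp: r1 r2 r3 r4 r5 r6 r7 r8)
qed

lemma (in group) sb3_groupI:
  assumes "\<And>x. f x \<in> carrier G"
    and "\<And>l r. (l, r) \<in> sb3_rels \<Longrightarrow> eval_word G f l = eval_word G f r"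
  shows "sb3_group G (f Sigma1) (f Sigma2) (f Tau1) (f Tau2)"
proof -
  have "\<forall>(l, r) \<in> sb3_rels. eval_word G f l = eval_word G f r"
    using assms(2) by blast
  then show ?thesis
    unfolding sb3_rels_def using assms(1) by unfold_locales simp_all
qed

interpretation P: st3_group "presented_group st3_rels"
  "generator st3_rels A12" "generator st3_rels A13" "generator st3_rels A23"
  "generator st3_rels C12" "generator st3_rels C13" "generator st3_rels C23"
  by (rule P.st3_groupI) (simp_all only: generator_closed eval_word_presented_rel)

lemma next_coset_rel:
  assumes "(l, r) \<in> sb3_rels"
  shows "next_coset t l = next_coset t r"
  using assms by (cases t) (auto simp: sb3_rels_def)

text \<open>Thirty cases, five relations read from six cosets, each turned into an equation between
  products of generators of the presented group.\<close>

lemma rewrite_rel: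
  assumes "(l, r) \<in> sb3_rels"
  shows "word_congr st3_rels (rewrite t l) (rewrite t r)"
  using assms unfolding word_class_eq_iff[symmetric] eval_word_generator[symmetric]
  by (cases t)
    (auto simp: sb3_rels_def generator_closed P.m_assoc P.normalize P.normalize')

text \<open>An elementary change inside a word leaves the coset reached after it unchanged, so the
  suffix contributes the same word on both sides.\<close>

lemma rewrite_cong:
  assumes "word_congr sb3_rels u v"
  shows "next_coset t u = next_coset t v \<and> word_congr st3_rels (rewrite t u) (rewrite t v)"
  using assms
proof (induction arbitrary: t)
  case (gen_inv u x v)
  \<comment> \<open>Here \<open>w\<close> will be the word contributed by \<open>x\<close> from the
    coset reached after \<open>u\<close>; by \<open>next_gen_next_gen\<close> the following
    \<open>Inv x\<close> contributes its inverse.\<close>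
  have "word_congr st3_rels (rewrite t u @ (w @ inv_word w) @ v') (rewrite t u @ [] @ v')" for w v'
    by (intro word_congr_append word_congr.refl word_congr_inv_word')
  then show ?case by (simp add: next_coset_append rewrite_append)
next
  case (inv_gen u x v)
  have "word_congr st3_rels (rewrite t u @ (inv_word w @ w) @ v') (rewrite t u @ [] @ v')" for w v'
    by (intro word_congr_append word_congr.refl word_congr_inv_word)
  then show ?case by (simp add: next_coset_append rewrite_append)
next
  case (rel l r u v)
  then have "word_congr st3_rels (rewrite t u @ rewrite s l @ v') (rewrite t u @ rewrite s r @ v')"
    for s v'
    by (intro word_congr_append word_congr.refl rewrite_rel)
  with rel show ?case by (simp add: next_coset_append rewrite_append next_coset_rel)
next
  case (sym u v)
  then show ?case by (simp add: word_congr.sym)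
next
  case (trans u v w)
  then show ?case by (metis word_congr.trans)
qed (simp add: word_congr.refl)

section \<open>The kernel\<close>

interpretation SB3: group SB3
  by (rule SB3_is_group)

abbreviation sb3_gen :: "sb3_gen \<Rightarrow> sb3_gen word set" where
  "sb3_gen \<equiv> generator sb3_rels"

lemma sb3_gen_closed [simp]: "sb3_gen x \<in> carrier SB3"
  by (simp add: SB3_def generator_closed)

interpretation SB3: sb3_group SB3 "sb3_gen Sigma1" "sb3_gen Sigma2" "sb3_gen Tau1" "sb3_gen Tau2"
  by (rule SB3.sb3_groupI, simp, unfold SB3_def) (rule eval_word_presented_rel)

text \<open>Powers and left-nested products are replaced by the terms of the locale. The original
  equations would compete with these, hence \<open>del: st3_elem.simps\<close> below.\<close>

lemma st3_elem_simps:
  "st3_elem A12 = sb3_gen Sigma1 \<otimes>\<^bsub>SB3\<^esub> sb3_gen Sigma1"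
  "st3_elem A23 = sb3_gen Sigma2 \<otimes>\<^bsub>SB3\<^esub> sb3_gen Sigma2"
  "st3_elem A13 = SB3.a13"
  "st3_elem C12 = sb3_gen Tau1"
  "st3_elem C23 = sb3_gen Tau2"
  "st3_elem C13 = SB3.c13"
  by (simp_all add: \<sigma>\<^sub>1_def \<sigma>\<^sub>2_def \<tau>\<^sub>1_def \<tau>\<^sub>2_def numeral_2_eq_2 SB3.a13_def SB3.c13_def SB3.m_assoc)

lemma st3_elem_closed: "st3_elem g \<in> carrier SB3"
  by (cases g) (simp_all only: st3_elem_simps sb3_gen_closed SB3.closed' SB3.m_closed)

lemma st3_elem_group: "st3_group SB3
  (st3_elem A12) (st3_elem A13) (st3_elem A23) (st3_elem C12) (st3_elem C13) (st3_elem C23)"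
  unfolding st3_elem_simps by (rule SB3.st3_group)

lemma st3_elem_rels:
  assumes "(l, r) \<in> st3_rels"
  shows "eval_word SB3 st3_elem l = eval_word SB3 st3_elem r"
  using assms by (rule SB3.st3_groupD[OF st3_elem_closed st3_elem_group])

abbreviation eval_st3 :: "st3_gen word \<Rightarrow> sb3_gen word set" where
  "eval_st3 \<equiv> eval_word SB3 st3_elem"

lemmas eval_st3_closed = eval_word_closed[OF SB3_is_group st3_elem_closed st3_elem_rels]
lemmas eval_st3_append = eval_word_append[OF SB3_is_group st3_elem_closed st3_elem_rels]

section \<open>Decomposition of elements of the singular braid group along the transversal\<close>

lemma sb3_eval_word: "eval_word SB3 sb3_gen w = word_class sb3_rels w"
  by (simp add: SB3_def eval_word_generator)

lemma sb3_class_closed: "word_class sb3_rels w \<in> carrier SB3"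
  by (simp add: SB3_def presented_group_carrier)

lemma sb3_one: "word_class sb3_rels [] = \<one>\<^bsub>SB3\<^esub>"
  by (simp add: SB3_def presented_group_one)

lemma rep_mult_gen:
  "word_class sb3_rels (rep t) \<otimes>\<^bsub>SB3\<^esub> sb3_gen x =
    eval_st3 (rewrite_gen t x) \<otimes>\<^bsub>SB3\<^esub> word_class sb3_rels (rep (next_gen t x))"
proof -
  \<comment> \<open>Apart from the braid relation, all relations are oriented to push tau letters to
    the right of sigma letters.\<close>
  note rels = SB3.braid SB3.xs[symmetric] SB3.yt[symmetric] SB3.xys[symmetric] SB3.yxt[symmetric]
  note rels' = rels rels[THEN SB3.eq_imp_mult_eq] SB3.braid[THEN SB3.eq_imp_mult_eq3]
    SB3.xys[symmetric, THEN SB3.eq_imp_mult_eq3] SB3.yxt[symmetric, THEN SB3.eq_imp_mult_eq3]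
  show ?thesis
    unfolding sb3_eval_word[symmetric]
    by (cases t; cases x)
      (simp_all add: rels' st3_elem_simps SB3.m_assoc SB3.inv_mult_group SB3.a13_def SB3.c13_def
        del: st3_elem.simps)
qed

lemma rep_mult_letter:
  "word_class sb3_rels (rep t) \<otimes>\<^bsub>SB3\<^esub> eval_letter SB3 sb3_gen a =
    eval_st3 (rewrite_letter t a) \<otimes>\<^bsub>SB3\<^esub> word_class sb3_rels (rep (next_letter t a))"
proof (cases a)
  case (Gen x)
  then show ?thesis by (simp add: rep_mult_gen)
next
  case (Inv x)
  \<comment> \<open>The edge is taken from its far end, where \<open>x\<close> leads back to
    \<open>t\<close>; solving for the representative there gives the claim for
    \<open>Inv x\<close>.\<close>
  have "word_class sb3_rels (rep (next_gen t x)) \<otimes>\<^bsub>SB3\<^esub> sb3_gen x =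
      eval_st3 (rewrite_gen (next_gen t x) x) \<otimes>\<^bsub>SB3\<^esub> word_class sb3_rels (rep t)"
    using rep_mult_gen[of "next_gen t x" x] by simp
  then have "word_class sb3_rels (rep (next_gen t x)) =
      eval_st3 (rewrite_gen (next_gen t x) x) \<otimes>\<^bsub>SB3\<^esub> word_class sb3_rels (rep t) \<otimes>\<^bsub>SB3\<^esub> inv\<^bsub>SB3\<^esub> sb3_gen x"
    by (simp add: SB3.inv_solve_right eval_st3_closed sb3_class_closed)
  with Inv show ?thesis
    by (simp add: SB3.eval_inv_word[OF st3_elem_closed] eval_st3_closed sb3_class_closed SB3.m_assoc)
qed

lemma rep_mult_word:
  "word_class sb3_rels (rep t) \<otimes>\<^bsub>SB3\<^esub> eval_word SB3 sb3_gen w =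
    eval_st3 (rewrite t w) \<otimes>\<^bsub>SB3\<^esub> word_class sb3_rels (rep (next_coset t w))"
proof (induction w arbitrary: t)
  case Nil
  show ?case by (simp add: sb3_class_closed)
next
  case (Cons a w)
  have [simp]: "eval_word SB3 sb3_gen w \<in> carrier SB3" "eval_letter SB3 sb3_gen a \<in> carrier SB3"
    by (simp_all add: sb3_eval_word sb3_class_closed) (cases a; simp)
  have "word_class sb3_rels (rep t) \<otimes>\<^bsub>SB3\<^esub> eval_word SB3 sb3_gen (a # w) =
      (word_class sb3_rels (rep t) \<otimes>\<^bsub>SB3\<^esub> eval_letter SB3 sb3_gen a) \<otimes>\<^bsub>SB3\<^esub> eval_word SB3 sb3_gen w"
    by (simp add: SB3.m_assoc sb3_class_closed)
  then show ?case
    by (simp add: rep_mult_letter SB3.m_assoc sb3_class_closed eval_st3_closed eval_st3_append Cons.IH)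
qed

text \<open>The first factor lies in the kernel, so \<open>\<pi>\<close> sees only the
  representative.\<close>

lemma word_class_decomp:
  "word_class sb3_rels w =
    eval_st3 (rewrite E w) \<otimes>\<^bsub>SB3\<^esub> word_class sb3_rels (rep (next_coset E w))"
  using rep_mult_word[of E w]
  by (simp add: sb3_eval_word sb3_class_closed sb3_one)

section \<open>The kernel as the set of values of words in the six generators\<close>

interpretation pi: group_hom SB3 "sym_group 3" \<pi>
  by (intro group_hom.intro group_hom_axioms.intro SB3_is_group sym_group_is_group \<pi>_hom)

lemma pi_word_class: "\<pi> (word_class sb3_rels w) = eval_word (sym_group 3) sb3_perm w"
  unfolding \<pi>_def by (rule induced_hom_word_class[OF sym_group_is_group sb3_perm_closed sb3_perm_rels])

lemma pi_rep_eq_one: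
  assumes "\<pi> (word_class sb3_rels (rep t)) = \<one>\<^bsub>sym_group 3\<^esub>"
  shows "t = E"
  \<comment> \<open>A permutation of three symbols fixing 1 and 2 is the identity, so these two
    values exclude the other five representatives.\<close>
  using fun_cong[OF assms, of 1] fun_cong[OF assms, of 2]
  by (cases t) (simp_all add: pi_word_class sym_group_mult sym_group_one transpose_def)

lemma pi_st3_elem: "\<pi> (st3_elem g) = \<one>\<^bsub>sym_group 3\<^esub>"
proof -
  have "\<pi> (sb3_gen x) = sb3_perm x" for x
    unfolding \<pi>_def by (rule induced_hom_generator[OF sym_group_is_group sb3_perm_closed sb3_perm_rels])
  \<comment> \<open>The conjugates \<open>A13\<close> and \<open>C13\<close> involve the inverse of
    \<open>Sigma2\<close>, whose image is a transposition.\<close>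
  moreover have "inv\<^bsub>sym_group 3\<^esub> sb3_perm Sigma2 = sb3_perm Sigma2"
    by (rule group.inv_equality[OF sym_group_is_group])
      (simp_all only: sb3_perm_closed, simp add: sym_group_mult sym_group_one)
  ultimately show ?thesis
    by (cases g) (simp_all add: st3_elem_simps SB3.a13_def SB3.c13_def pi.hom_inv
        sym_group_mult sym_group_one comp_assoc del: st3_elem.simps, simp_all flip: comp_assoc)
qed

lemma st3_elem_in_kernel: "st3_elem g \<in> kernel SB3 (sym_group 3) \<pi>"
  unfolding kernel_def using pi_st3_elem st3_elem_closed by blast

lemma eval_st3_in_kernel: "eval_st3 w \<in> kernel SB3 (sym_group 3) \<pi>"
proof (induction w)
  case Nil
  show ?case
    using subgroup.one_closed[OF pi.subgroup_kernel] by simp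
next
  case (Cons a w)
  have "eval_letter SB3 st3_elem a \<in> kernel SB3 (sym_group 3) \<pi>"
    using st3_elem_in_kernel subgroup.m_inv_closed[OF pi.subgroup_kernel]
    by (metis eval_letter.simps letter.exhaust)
  then show ?case
    using Cons subgroup.m_closed[OF pi.subgroup_kernel] by (simp only: eval_word.simps)
qed

text \<open>Applying \<open>\<pi>\<close> to the decomposition of a kernel element shows that its
  representative maps to the identity, hence is trivial.\<close>

lemma kernel_eq: "kernel SB3 (sym_group 3) \<pi> = range eval_st3"
proof
  show "kernel SB3 (sym_group 3) \<pi> \<subseteq> range eval_st3"
  proof
    fix A assume A: "A \<in> kernel SB3 (sym_group 3) \<pi>"
    then obtain w where w: "A = word_class sb3_rels w"
      by (auto simp: kernel_def SB3_def presented_group_carrier)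
    have "\<pi> (eval_st3 (rewrite E w)) = \<one>\<^bsub>sym_group 3\<^esub>"
      using eval_st3_in_kernel by (simp add: kernel_def)
    moreover have "\<pi> (word_class sb3_rels w) = \<one>\<^bsub>sym_group 3\<^esub>"
      using A w by (simp add: kernel_def)
    ultimately have "\<pi> (word_class sb3_rels (rep (next_coset E w))) = \<one>\<^bsub>sym_group 3\<^esub>"
      using word_class_decomp[of w] by (simp add: eval_st3_closed sb3_class_closed)
    then have "next_coset E w = E"
      by (rule pi_rep_eq_one)
    then have "A = eval_st3 (rewrite E w)"
      using word_class_decomp[of w] w by (simp add: eval_st3_closed sb3_one)
    then show "A \<in> range eval_st3" by blast
  qed
qed (auto intro: eval_st3_in_kernel)

lemma eval_st3_in_generate: "eval_st3 w \<in> generate SB3 (range st3_elem)"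
proof (induction w)
  case Nil
  show ?case by (simp add: generate.one)
next
  case (Cons a w)
  have "eval_letter SB3 st3_elem a \<in> generate SB3 (range st3_elem)"
    by (cases a) (auto intro: generate.incl generate.inv simp del: st3_elem.simps)
  with Cons show ?case by (simp add: generate.eng)
qed

lemma kernel_eq_generate: "kernel SB3 (sym_group 3) \<pi> = generate SB3 (range st3_elem)"
proof
  show "kernel SB3 (sym_group 3) \<pi> \<subseteq> generate SB3 (range st3_elem)"
    using eval_st3_in_generate by (auto simp: kernel_eq)
  have "range st3_elem \<subseteq> kernel SB3 (sym_group 3) \<pi>"
    using st3_elem_in_kernel by blast
  then show "generate SB3 (range st3_elem) \<subseteq> kernel SB3 (sym_group 3) \<pi>"
    by (rule SB3.generate_subgroup_incl[OF _ pi.subgroup_kernel])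
qed

section \<open>Injectivity\<close>

text \<open>Lifts \<open>st3_elem\<close> from group elements to words, on which
  \<open>rewrite\<close> acts.\<close>

fun subst_gen :: "st3_gen \<Rightarrow> sb3_gen word" where
  "subst_gen A12 = [Gen Sigma1, Gen Sigma1]"
| "subst_gen A23 = [Gen Sigma2, Gen Sigma2]"
| "subst_gen A13 = [Gen Sigma2, Gen Sigma1, Gen Sigma1, Inv Sigma2]"
| "subst_gen C12 = [Gen Tau1]"
| "subst_gen C23 = [Gen Tau2]"
| "subst_gen C13 = [Gen Sigma2, Gen Tau1, Inv Sigma2]"

fun subst_letter :: "st3_gen letter \<Rightarrow> sb3_gen word" where
  "subst_letter (Gen g) = subst_gen g"
| "subst_letter (Inv g) = inv_word (subst_gen g)"

definition subst :: "st3_gen word \<Rightarrow> sb3_gen word" where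
  "subst w = concat (map subst_letter w)"

text \<open>The path read from \<open>E\<close> returns to \<open>E\<close>, and exactly one of its
  edges carries a nonempty word. The result is therefore an equality of lists, not merely a
  congruence.\<close>

lemma rewrite_subst_letter:
  "rewrite E (subst_letter a) = [a] \<and> next_coset E (subst_letter a) = E"
proof (cases a)
  case (Gen g)
  then show ?thesis by (cases g) auto
next
  case (Inv g)
  then show ?thesis by (cases g) auto
qed

lemma rewrite_subst: "rewrite E (subst w) = w"
  by (induction w) (auto simp: subst_def rewrite_append rewrite_subst_letter)

lemma word_class_subst_gen: "word_class sb3_rels (subst_gen g) = st3_elem g"
  unfolding sb3_eval_word[symmetric]
  by (cases g) (simp_all add: st3_elem_simps SB3.a13_def SB3.c13_def del: st3_elem.simps)

lemma word_class_subst: "word_class sb3_rels (subst w) = eval_st3 w"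
proof (induction w)
  case Nil
  show ?case by (simp add: subst_def sb3_one)
next
  case (Cons a w)
  have "word_class sb3_rels (subst_letter a) = eval_letter SB3 st3_elem a"
    by (cases a) (simp_all add: word_class_subst_gen word_class_inv_word flip: SB3_def del: st3_elem.simps)
  then show ?case
    using Cons presented_group_mult[of sb3_rels "subst_letter a" "subst w"]
    by (simp add: subst_def flip: SB3_def)
qed

text \<open>Equal values make the substituted words congruent in the singular braid group;
  \<open>rewrite E\<close> respects this congruence and undoes the substitution.\<close>

lemma eval_st3_inj:
  assumes "eval_st3 u = eval_st3 v"
  shows "word_congr st3_rels u v"
  using assms rewrite_cong[of "subst u" "subst v" E]
  by (simp add: rewrite_subst word_class_eq_iff flip: word_class_subst)

theorem theorem3p8:
  shows "carrier ST3 = generate SB3 (range st3_elem) \<and> is_presentation ST3 st3_elem st3_rels"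
proof
  show "carrier ST3 = generate SB3 (range st3_elem)"
    by (simp add: ST3_def kernel_eq_generate)
  let ?h = "induced_hom SB3 st3_elem"
  have h: "?h (word_class st3_rels w) = eval_st3 w" for w
    by (rule induced_hom_word_class[OF SB3_is_group st3_elem_closed st3_elem_rels])
  have "?h \<in> hom (presented_group st3_rels) SB3"
    by (rule induced_hom_in_hom[OF SB3_is_group st3_elem_closed st3_elem_rels])
  \<comment> \<open>\<open>ST3\<close> has the multiplication of \<open>SB3\<close>, so only
    membership of the values in the kernel remains.\<close>
  then have "?h \<in> hom (presented_group st3_rels) ST3"
    by (auto simp: hom_def ST3_def presented_group_carrier h eval_st3_in_kernel)
  moreover have "inj_on ?h (carrier (presented_group st3_rels))"
    by (auto simp: inj_on_def presented_group_carrier h word_class_eq_iff eval_st3_inj)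
  moreover have "?h ` carrier (presented_group st3_rels) = carrier ST3"
    by (auto simp: presented_group_carrier image_image h ST3_def kernel_eq)
  ultimately have "?h \<in> iso (presented_group st3_rels) ST3"
    by (simp add: iso_def bij_betw_def)
  moreover have "?h (generator st3_rels g) = st3_elem g" for g
    by (rule induced_hom_generator[OF SB3_is_group st3_elem_closed st3_elem_rels])
  moreover have "group ST3"
    unfolding ST3_def by (rule SB3.subgroup_imp_group[OF pi.subgroup_kernel])
  ultimately show "is_presentation ST3 st3_elem st3_rels"
    unfolding is_presentation_def by blast
qed

end
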